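(* Let $\alpha>1$, $l\ge 0$, and consider the pursuit-evasion game on $X=\mathbb{R}^2$ (no obstacles) with capture radius $l$. Let $t_0\in\mathbb{R}$ be an initial time and $\mathbf{x}_0=(x_{p0},x_{e0})$ an initial state with $\|x_{p0}-x_{e0}\|>l$, and let $\delta^*=\delta^*_{t_0,\mathbf{x}_0}$ be the non-anticipative pursuer strategy defined in the context. Then: (a) there exists a constant $c>0$ such that $t_f(\delta^*[u_e],u_e)<c$ for every $u_e\in\mathcal{U}_{t_0}$; (b) for every $u_e\in\mathcal{U}_{t_0}$ and every $t\in[t_0,t_f(\delta^*[u_e],u_e))$, one has $x_e(t;u_e)\in\mathcal{D}_l(x_{p0},x_{e0})$.
   Context: Game. The pursuer and the evader move in $\mathbb{R}^2$ with $\dot x_p(t)=\alpha u_p(t)$, $\dot x_e(t)=u_e(t)$, $x_p(t_0)=x_{p0}$, $x_e(t_0)=x_{e0}$, where $\alpha>1$. $\mathcal{U}_{t_0}$ is the set of piecewise continuous functions $u:[t_0,+\infty)\to\{v\in\mathbb{R}^2:\|v\|=1\}$; both players' controls range over $\mathcal{U}_{t_0}$. Trajectories are denoted $x_p(t;u_p)$, $x_e(t;u_e)$. The terminal time is $t_f(u_p,u_e)=\inf\{t\ge t_0:\|x_p(t;u_p)-x_e(t;u_e)\|\le l\}$, with $\inf\emptyset=+\infty$. Dominance region. $\mathcal{D}_l(x_1,x_2)=\{x\in\mathbb{R}^2:\|x-x_1\|-\alpha\|x-x_2\|>l\}$. When $\|x_1-x_2\|>l$ it is a bounded strictly convex open set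 containing $x_2$, with boundary a simple closed curve. Non-anticipative strategy. A map $\delta:\mathcal{U}_{t_0}\to\mathcal{U}_{t_0}$ such that for all $t'>t_0$, if $u_e=u_e'$ a.e. on $[t_0,t']$ then $\delta[u_e]=\delta[u_e']$ a.e. on $[t_0,t']$. The strategy $\delta^*$. For $\|x_p-x_e\|>l$ and a unit vector $u_e$, let $x_c(x_p,x_e,u_e)$ be the unique intersection point of the ray starting at $x_e$ in direction $u_e$ with $\partial\mathcal{D}_l(x_p,x_e)$, and put $$\gamma(x_p,x_e,u_e)=\frac{x_c(x_p,x_e,u_e)-x_p}{\|x_c(x_p,x_e,u_e)-x_p\|}.$$ Given $u_e\in\mathcal{U}_{t_0}$, let $x_p(\cdot)$ solve $\dot x_p(t)=\alpha\,\gamma(x_p(t),x_e(t;u_e),u_e(t))$, $x_p(t_0)=x_{p0}$, up to the terminal time; then $\delta^*[u_e](t)=\gamma(x_p(t),x_e(t;u_e),u_e(t))$ before the terminal time (after the terminal time the strategy is extended in any suitable non-anticipative manner, which is irrelevant). *)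

theory Defs
  imports "HOL-Analysis.Analysis"
begin

(* Piecewise continuity on [t0, oo) in the standard sense: finitely many discontinuities in every
   compact subinterval, and finite one-sided limits everywhere.  Values before t0 are irrelevant. *)
definition piecewise_continuous_from :: "real \<Rightarrow> (real \<Rightarrow> real^2) \<Rightarrow> bool" where
  "piecewise_continuous_from t0 u \<longleftrightarrow>
     (\<forall>T>t0. \<exists>S. finite S \<and> continuous_on ({t0..T} - S) u) \<and>
     (\<forall>t\<ge>t0. \<exists>L. (u \<longlongrightarrow> L) (at_right t)) \<and>
     (\<forall>t>t0. \<exists>L. (u \<longlongrightarrow> L) (at_left t))"

definition controls :: "real \<Rightarrow> (real \<Rightarrow> real^2) set" where
  "controls t0 = {u. piecewise_continuous_from t0 u \<and> (\<forall>t\<ge>t0. norm (u t) = 1)}"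

(* The solution of x' = s u, x(t0) = x0.  As u is only piecewise continuous, the differential
   equation is understood off the discontinuities of u, with x continuous, i.e. in integral form. *)
definition trajectory :: "real \<Rightarrow> real \<Rightarrow> real^2 \<Rightarrow> (real \<Rightarrow> real^2) \<Rightarrow> real \<Rightarrow> real^2" where
  "trajectory s t0 x0 u t = x0 + s *\<^sub>R integral {t0..t} u"

(* The infimum is taken in the extended reals, so that the empty set yields infinity. *)
definition capture_time ::
    "real \<Rightarrow> real \<Rightarrow> (real \<Rightarrow> real^2) \<Rightarrow> (real \<Rightarrow> real^2) \<Rightarrow> ereal" where
  "capture_time l t0 xp xe = Inf (ereal ` {t. t0 \<le> t \<and> norm (xp t - xe t) \<le> l})"

definition terminal_time ::
    "real \<Rightarrow> real \<Rightarrow> real \<Rightarrow> real^2 \<Rightarrow> real^2 \<Rightarrow> (real \<Rightarrow> real^2) \<Rightarrow> (real \<Rightarrow> real^2) \<Rightarrow> ereal" where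
  "terminal_time \<alpha> l t0 xp0 xe0 up ue =
     capture_time l t0 (trajectory \<alpha> t0 xp0 up) (trajectory 1 t0 xe0 ue)"

definition dominance_region :: "real \<Rightarrow> real \<Rightarrow> real^2 \<Rightarrow> real^2 \<Rightarrow> (real^2) set" where
  "dominance_region \<alpha> l x1 x2 = {x. norm (x - x1) - \<alpha> * norm (x - x2) > l}"

definition nonanticipative ::
    "real \<Rightarrow> ((real \<Rightarrow> real^2) \<Rightarrow> (real \<Rightarrow> real^2)) \<Rightarrow> bool" where
  "nonanticipative t0 \<delta> \<longleftrightarrow>
     \<delta> \<in> controls t0 \<rightarrow> controls t0 \<and>
     (\<forall>t'>t0. \<forall>ue\<in>controls t0. \<forall>ue'\<in>controls t0.
        (AE t in lborel. t \<in> {t0..t'} \<longrightarrow> ue t = ue' t) \<longrightarrow>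
        (AE t in lborel. t \<in> {t0..t'} \<longrightarrow> \<delta> ue t = \<delta> ue' t))"

definition ray_exit_point :: "real \<Rightarrow> real \<Rightarrow> real^2 \<Rightarrow> real^2 \<Rightarrow> real^2 \<Rightarrow> real^2" where
  "ray_exit_point \<alpha> l xp xe u =
     (THE x. x \<in> {xe + s *\<^sub>R u |s. 0 \<le> s} \<inter> frontier (dominance_region \<alpha> l xp xe))"

definition pursuit_direction :: "real \<Rightarrow> real \<Rightarrow> real^2 \<Rightarrow> real^2 \<Rightarrow> real^2 \<Rightarrow> real^2" where
  "pursuit_direction \<alpha> l xp xe u =
     (1 / norm (ray_exit_point \<alpha> l xp xe u - xp)) *\<^sub>R (ray_exit_point \<alpha> l xp xe u - xp)"

(* xp solves the feedback equation xp' = \<alpha> \<gamma>(xp, xe, ue) up to the time of capture along xp itself,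
   again in integral form.  The values of xp after capture are irrelevant, but xp must not jump
   there: otherwise a jump could bring the infimum in the capture time forward. *)
definition feedback_solution ::
    "real \<Rightarrow> real \<Rightarrow> real \<Rightarrow> real^2 \<Rightarrow> (real \<Rightarrow> real^2) \<Rightarrow> (real \<Rightarrow> real^2) \<Rightarrow> (real \<Rightarrow> real^2) \<Rightarrow> bool"
  where
  "feedback_solution \<alpha> l t0 xp0 xe ue xp \<longleftrightarrow>
     continuous_on {t0..} xp \<and>
     (\<forall>t\<ge>t0. ereal t \<le> capture_time l t0 xp xe \<longrightarrow>
        ((\<lambda>s. \<alpha> *\<^sub>R pursuit_direction \<alpha> l (xp s) (xe s) (ue s)) has_integral (xp t - xp0)) {t0..t})"

(* A predicate rather than a function, because the strategy is prescribed only before the terminal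
   time and may be continued afterwards in any non-anticipative way. *)
definition is_delta_star ::
    "real \<Rightarrow> real \<Rightarrow> real \<Rightarrow> real^2 \<Rightarrow> real^2 \<Rightarrow> ((real \<Rightarrow> real^2) \<Rightarrow> (real \<Rightarrow> real^2)) \<Rightarrow> bool" where
  "is_delta_star \<alpha> l t0 xp0 xe0 \<delta> \<longleftrightarrow>
     nonanticipative t0 \<delta> \<and>
     (\<forall>ue\<in>controls t0. \<exists>xp.
        feedback_solution \<alpha> l t0 xp0 (trajectory 1 t0 xe0 ue) ue xp \<and>
        (\<forall>t\<ge>t0. ereal t < capture_time l t0 xp (trajectory 1 t0 xe0 ue) \<longrightarrow>
           \<delta> ue t = pursuit_direction \<alpha> l (xp t) (trajectory 1 t0 xe0 ue t) (ue t)))"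

end

theory Submission
  imports Defs
begin

text \<open>
  Write \<open>z = xe - xp\<close>, and let \<open>\<sigma>\<close> be the distance from the evader to the exit point, so that
  \<open>\<gamma> = (z + \<sigma> u) / (l + \<alpha> \<sigma>)\<close>. For (a), a computation with \<open>(\<alpha> - 1) \<sigma> \<le> norm z - l\<close> shows that
  \<open>norm z\<close> decreases at rate at least \<open>(\<alpha> - 1)\<^sup>2 / \<alpha>\<close>. For (b), fix a point \<open>y\<close> and
  let \<open>\<epsilon> = norm (y - xp) - \<alpha> * norm (y - xe) - l\<close>, which is positive exactly when \<open>y\<close> lies in the current
  dominance region. The law of cosines in the triangles that \<open>y\<close> and the exit point form with
  \<open>xe\<close> and with \<open>xp\<close> gives \<open>\<epsilon>' \<le> K \<epsilon>\<^sup>2\<close> as long as \<open>\<epsilon> \<ge> 0\<close>, with \<open>K\<close> bounded before capture. By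
  Gronwall's inequality \<open>\<epsilon>\<close> cannot become positive, while \<open>\<epsilon> > 0\<close> at any time before capture at which the
  evader is at \<open>y\<close>.
\<close>

section \<open>Exit of a ray from the dominance region\<close>

text \<open>The positive root \<open>s\<close> of \<open>(norm (z + s *\<^sub>R u))\<^sup>2 = (l + \<alpha> * s)\<^sup>2\<close>.\<close>

definition exit_dist :: "real \<Rightarrow> real \<Rightarrow> real^2 \<Rightarrow> real^2 \<Rightarrow> real" where
  "exit_dist \<alpha> l z u =
     (z \<bullet> u - \<alpha> * l + sqrt ((\<alpha> * l - z \<bullet> u)\<^sup>2 + (\<alpha>\<^sup>2 - 1) * ((norm z)\<^sup>2 - l\<^sup>2))) / (\<alpha>\<^sup>2 - 1)"

lemma norm_ray_squared:
  fixes z u :: "'a::real_inner"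
  assumes "norm u = 1"
  shows "(norm (z + s *\<^sub>R u))\<^sup>2 = (norm z)\<^sup>2 + 2 * s * (z \<bullet> u) + s\<^sup>2"
proof -
  have "u \<bullet> u = 1" using assms by (simp add: norm_eq_1)
  then show ?thesis
    unfolding power2_norm_eq_inner
    by (simp add: inner_left_distrib inner_right_distrib inner_commute power2_eq_square)
qed

text \<open>Multiplication by \<open>k\<close> turns the difference of the squares of the two sides
  into \<open>D\<^sup>2 - (k * s + b)\<^sup>2\<close>. Of its two factors,
  \<open>k * s + b + D\<close> is positive for \<open>s \<ge> 0\<close> because \<open>D\<close>
  exceeds the modulus of \<open>b\<close>, so the other one, which vanishes only at
  \<open>exit_dist\<close>, decides the sign.\<close>

lemma
  fixes z u :: "real^2"
  assumes "\<alpha> > 1" "l \<ge> 0" "norm z > l" "norm u = 1"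
  shows exit_dist_pos: "exit_dist \<alpha> l z u > 0"
    and ray_inside_iff: "s \<ge> 0 \<Longrightarrow> norm (z + s *\<^sub>R u) > l + \<alpha> * s \<longleftrightarrow> s < exit_dist \<alpha> l z u"
    and ray_boundary_iff: "s \<ge> 0 \<Longrightarrow> norm (z + s *\<^sub>R u) = l + \<alpha> * s \<longleftrightarrow> s = exit_dist \<alpha> l z u"
proof -
  define k where "k = \<alpha>\<^sup>2 - 1"
  define b where "b = \<alpha> * l - z \<bullet> u"
  define c where "c = (norm z)\<^sup>2 - l\<^sup>2"
  define D where "D = sqrt (b\<^sup>2 + k * c)"
  have k: "k > 0" unfolding k_def using assms(1) by (simp add: power2_eq_square less_1_mult)
  have c: "c > 0" unfolding c_def using assms by (simp add: power_strict_mono)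
  have D2: "D\<^sup>2 = b\<^sup>2 + k * c" unfolding D_def using k c by simp
  have Db: "D > \<bar>b\<bar>"
    unfolding D_def by (rule real_less_rsqrt) (use k c in simp)
  have e: "exit_dist \<alpha> l z u = (D - b) / k"
    unfolding exit_dist_def D_def b_def c_def k_def by (simp add: algebra_simps)
  show "exit_dist \<alpha> l z u > 0" unfolding e using k Db by simp
  fix s :: real assume s: "s \<ge> 0"
  have "k * ((norm (z + s *\<^sub>R u))\<^sup>2 - (l + \<alpha> * s)\<^sup>2) = D\<^sup>2 - (k * s + b)\<^sup>2"
    unfolding D2 norm_ray_squared[OF assms(4)] k_def b_def c_def
    by (simp add: power2_eq_square algebra_simps)
  also have "\<dots> = (D - b - k * s) * (k * s + b + D)" by (simp add: power2_eq_square algebra_simps)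
  finally have f: "k * ((norm (z + s *\<^sub>R u))\<^sup>2 - (l + \<alpha> * s)\<^sup>2) = (D - b - k * s) * (k * s + b + D)" .
  have p: "k * s + b + D > 0" using k s Db by (smt (verit) mult_nonneg_nonneg)
  have n: "l + \<alpha> * s \<ge> 0" using assms s by simp
  have "norm (z + s *\<^sub>R u) > l + \<alpha> * s \<longleftrightarrow> (norm (z + s *\<^sub>R u))\<^sup>2 > (l + \<alpha> * s)\<^sup>2"
    using n by (simp add: power2_less_imp_less power_strict_mono order.strict_iff_not power_mono_iff)
  also have "\<dots> \<longleftrightarrow> k * ((norm (z + s *\<^sub>R u))\<^sup>2 - (l + \<alpha> * s)\<^sup>2) > 0"
    using k by (simp add: zero_less_mult_iff)
  also have "\<dots> \<longleftrightarrow> s < exit_dist \<alpha> l z u"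
    unfolding f e using p k by (simp add: zero_less_mult_iff pos_less_divide_eq mult.commute)
  finally show "norm (z + s *\<^sub>R u) > l + \<alpha> * s \<longleftrightarrow> s < exit_dist \<alpha> l z u" .
  have "norm (z + s *\<^sub>R u) = l + \<alpha> * s \<longleftrightarrow> (norm (z + s *\<^sub>R u))\<^sup>2 = (l + \<alpha> * s)\<^sup>2"
    using n by (simp add: power2_eq_iff_nonneg)
  also have "\<dots> \<longleftrightarrow> k * ((norm (z + s *\<^sub>R u))\<^sup>2 - (l + \<alpha> * s)\<^sup>2) = 0"
    using k by simp
  also have "\<dots> \<longleftrightarrow> s = exit_dist \<alpha> l z u"
  proof -
    have "k * s + b + D \<noteq> 0" using p by simp
    then have "(D - b - k * s) * (k * s + b + D) = 0 \<longleftrightarrow> D - b = s * k"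
      by (simp only: mult_eq_0_iff) (auto simp: mult.commute)
    also have "\<dots> \<longleftrightarrow> s = (D - b) / k" using k by (auto simp: nonzero_eq_divide_eq)
    finally show ?thesis unfolding f e .
  qed
  finally show "norm (z + s *\<^sub>R u) = l + \<alpha> * s \<longleftrightarrow> s = exit_dist \<alpha> l z u" .
qed

text \<open>The region is open, so it misses its frontier, while the weak inequality is closed and
  passes to the closure.\<close>

lemma frontier_dominance_region_subset:
  "frontier (dominance_region \<alpha> l x1 x2) \<subseteq> {x. norm (x - x1) - \<alpha> * norm (x - x2) = l}"
proof -
  have o: "open (dominance_region \<alpha> l x1 x2)"
    unfolding dominance_region_def by (intro open_Collect_less continuous_intros)
  have "closure (dominance_region \<alpha> l x1 x2) \<subseteq> {x. norm (x - x1) - \<alpha> * norm (x - x2) \<ge> l}"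
    by (rule closure_minimal)
      (auto simp: dominance_region_def intro!: closed_Collect_le continuous_intros)
  then show ?thesis
    using o by (auto simp: frontier_def interior_open dominance_region_def intro!: antisym)
qed

text \<open>Approaching \<sigma> from the left along the ray puts the point at \<sigma> in the
  closure of the region but not in its interior. Uniqueness holds because a frontier point satisfies
  the boundary equation, which has only one solution on the ray.\<close>

lemma ray_exit_point_eq:
  fixes xp xe u :: "real^2"
  assumes "\<alpha> > 1" "l \<ge> 0" "norm (xp - xe) > l" "norm u = 1"
  shows "ray_exit_point \<alpha> l xp xe u = xe + exit_dist \<alpha> l (xe - xp) u *\<^sub>R u"
proof -
  let ?D = "dominance_region \<alpha> l xp xe"
  define \<sigma> where "\<sigma> = exit_dist \<alpha> l (xe - xp) u"
  have z: "norm (xe - xp) > l" using assms(3) by (simp add: norm_minus_commute)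
  note A = assms(1,2) z assms(4)
  have pos: "\<sigma> > 0" unfolding \<sigma>_def by (rule exit_dist_pos[OF A])
  have sh: "xe + s *\<^sub>R u - xp = xe - xp + s *\<^sub>R u" for s by simp
  have inside: "xe + s *\<^sub>R u \<in> ?D \<longleftrightarrow> s < \<sigma>" if "s \<ge> 0" for s
    using ray_inside_iff[OF A that] that assms(4)
    by (auto simp: dominance_region_def \<sigma>_def sh)
  have bd: "norm (xe + s *\<^sub>R u - xp) - \<alpha> * norm (xe + s *\<^sub>R u - xe) = l \<longleftrightarrow> s = \<sigma>" if "s \<ge> 0" for s
    using ray_boundary_iff[OF A that] that assms(4) by (auto simp: \<sigma>_def sh)
  have lim: "((\<lambda>s. xe + s *\<^sub>R u) \<longlongrightarrow> xe + \<sigma> *\<^sub>R u) (at_left \<sigma>)"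
    by (intro tendsto_intros)
  have "eventually (\<lambda>s. s \<in> {0<..<\<sigma>}) (at_left \<sigma>)"
    by (rule eventually_at_left_real[OF pos])
  then have "eventually (\<lambda>s. xe + s *\<^sub>R u \<in> closure ?D) (at_left \<sigma>)"
    by eventually_elim (auto simp: inside intro!: subsetD[OF closure_subset])
  then have "xe + \<sigma> *\<^sub>R u \<in> closure ?D"
    using Lim_in_closed_set[OF closed_closure _ _ lim] by simp
  moreover have "xe + \<sigma> *\<^sub>R u \<notin> interior ?D"
    using inside[of \<sigma>] pos interior_subset[of ?D] by auto
  ultimately have fr: "xe + \<sigma> *\<^sub>R u \<in> frontier ?D" by (simp add: frontier_def)
  show ?thesis
    unfolding ray_exit_point_def \<sigma>_def[symmetric]
  proof (rule the_equality)
    show "xe + \<sigma> *\<^sub>R u \<in> {xe + s *\<^sub>R u |s. 0 \<le> s} \<inter> frontier ?D"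
      using fr pos less_imp_le[OF pos] by blast
  next
    fix x assume "x \<in> {xe + s *\<^sub>R u |s. 0 \<le> s} \<inter> frontier ?D"
    then obtain s where s: "0 \<le> s" "x = xe + s *\<^sub>R u" "x \<in> frontier ?D" by auto
    with frontier_dominance_region_subset have "norm (x - xp) - \<alpha> * norm (x - xe) = l" by blast
    with bd[OF s(1)] s(2) show "x = xe + \<sigma> *\<^sub>R u" by blast
  qed
qed

section \<open>Closed form of the pursuit direction and the two rate estimates\<close>

lemma norm_exit_dist:
  fixes z u :: "real^2"
  assumes "\<alpha> > 1" "l \<ge> 0" "norm z > l" "norm u = 1"
  shows "norm (z + exit_dist \<alpha> l z u *\<^sub>R u) = l + \<alpha> * exit_dist \<alpha> l z u"
  using ray_boundary_iff[OF assms] exit_dist_pos[OF assms] by simp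

lemma pursuit_direction_eq:
  fixes xp xe u :: "real^2"
  assumes "\<alpha> > 1" "l \<ge> 0" "norm (xp - xe) > l" "norm u = 1"
  shows "pursuit_direction \<alpha> l xp xe u =
    (1 / (l + \<alpha> * exit_dist \<alpha> l (xe - xp) u)) *\<^sub>R (xe - xp + exit_dist \<alpha> l (xe - xp) u *\<^sub>R u)"
proof -
  have z: "norm (xe - xp) > l" using assms(3) by (simp add: norm_minus_commute)
  have sh: "xe + s *\<^sub>R u - xp = xe - xp + s *\<^sub>R u" for s by simp
  show ?thesis
    unfolding pursuit_direction_def ray_exit_point_eq[OF assms] sh
      norm_exit_dist[OF assms(1,2) z assms(4)] ..
qed

text \<open>The left side is \<open>z \<bullet> z'\<close> for the relative position
  \<open>z\<close>; divided by \<open>norm z\<close> it is the rate of change of the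
  distance.\<close>

lemma closing_speed:
  fixes xp xe u :: "real^2"
  assumes "\<alpha> > 1" "l \<ge> 0" "norm (xp - xe) > l" "norm u = 1"
  shows "(xe - xp) \<bullet> (u - \<alpha> *\<^sub>R pursuit_direction \<alpha> l xp xe u)
    \<le> - ((\<alpha> - 1)\<^sup>2 / \<alpha>) * norm (xe - xp)"
proof -
  define z where "z = xe - xp"
  have z: "norm z > l" unfolding z_def using assms(3) by (simp add: norm_minus_commute)
  note A = assms(1,2) z assms(4)
  define \<sigma> where "\<sigma> = exit_dist \<alpha> l z u"
  define d where "d = norm z"
  define B where "B = l + \<alpha> * \<sigma>"
  have pos: "\<sigma> > 0" unfolding \<sigma>_def by (rule exit_dist_pos[OF A])
  have B: "B > 0" unfolding B_def using assms pos by (simp add: add_nonneg_pos)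
  have nB: "norm (z + \<sigma> *\<^sub>R u) = B" unfolding B_def \<sigma>_def by (rule norm_exit_dist[OF A])
  have "B \<le> d + \<sigma>"
    unfolding d_def nB[symmetric] using norm_triangle_ineq[of z "\<sigma> *\<^sub>R u"] pos assms(4) by simp
  then have s1: "(\<alpha> - 1) * \<sigma> \<le> d - l" unfolding B_def by (simp add: algebra_simps)
  have "(\<alpha> - 1) * B = (\<alpha> - 1) * l + \<alpha> * ((\<alpha> - 1) * \<sigma>)" unfolding B_def by (simp add: algebra_simps)
  also have "\<dots> \<le> (\<alpha> - 1) * l + \<alpha> * (d - l)" using s1 assms by (intro add_left_mono mult_left_mono) auto
  also have "\<dots> \<le> \<alpha> * d" using assms(2) by (simp add: algebra_simps)
  finally have s2: "(\<alpha> - 1) * B \<le> \<alpha> * d" .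
  have zu: "z \<bullet> u \<le> d" unfolding d_def using norm_cauchy_schwarz[of z u] assms(4) by simp
  have "z \<bullet> (u - \<alpha> *\<^sub>R ((1 / B) *\<^sub>R (z + \<sigma> *\<^sub>R u))) = z \<bullet> u - (\<alpha> / B) * (d\<^sup>2 + \<sigma> * (z \<bullet> u))"
    unfolding d_def by (simp add: inner_diff inner_add power2_norm_eq_inner algebra_simps)
  \<comment> \<open>Since \<open>B = l + \<alpha> * \<sigma>\<close>, the terms containing
    \<open>\<sigma> * (z \<bullet> u)\<close> cancel.\<close>
  also have "\<dots> = (l * (z \<bullet> u) - \<alpha> * d\<^sup>2) / B"
    using B by (simp add: B_def field_simps)
  also have "\<dots> \<le> - ((\<alpha> - 1) * d\<^sup>2) / B"
  proof -
    have "l * (z \<bullet> u) \<le> l * d" using zu assms by (intro mult_left_mono) auto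
    also have "\<dots> \<le> d * d" using z assms unfolding d_def by (intro mult_right_mono) auto
    finally show ?thesis using B by (intro divide_right_mono) (auto simp: power2_eq_square algebra_simps)
  qed
  also have "\<dots> \<le> - ((\<alpha> - 1)\<^sup>2 / \<alpha>) * d"
  proof -
    have "((\<alpha> - 1) * d) * ((\<alpha> - 1) * B) \<le> ((\<alpha> - 1) * d) * (\<alpha> * d)"
      using s2 assms unfolding d_def by (intro mult_left_mono) auto
    then show ?thesis using B assms by (simp add: field_simps power2_eq_square)
  qed
  finally show ?thesis
    unfolding pursuit_direction_eq[OF assms] z_def[symmetric] B_def d_def \<sigma>_def .
qed

text \<open>Intended reading: \<open>A\<close> and \<open>B\<close> are the distances from the
  pursuer to \<open>y\<close> and to the exit point, \<open>r\<close> and \<sigma> those from the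
  evader, and \<open>p\<close>, \<open>e\<close> the cosines of the angles that these two points
  subtend at the pursuer and the evader. Both sides of \<open>law\<close> are then the squared
  distance from \<open>y\<close> to the exit point.\<close>

lemma cosine_comparison:
  fixes A B r \<sigma> p e \<alpha> \<epsilon> l :: real
  assumes law: "A\<^sup>2 + B\<^sup>2 - 2 * A * B * p = r\<^sup>2 + \<sigma>\<^sup>2 - 2 * r * \<sigma> * e"
    and "A = l + \<alpha> * r + \<epsilon>" "B = l + \<alpha> * \<sigma>" "e \<le> 1"
    and "\<alpha> > 1" "l \<ge> 0" "r \<ge> 0" "\<sigma> \<ge> 0" "\<epsilon> \<ge> 0"
  shows "2 * A * B * (e - p) * (\<alpha>\<^sup>2 - 1) \<le> \<epsilon>\<^sup>2"
proof -
  define q where "q = r - \<sigma>"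
  have k: "\<alpha>\<^sup>2 - 1 > 0" using assms by (simp add: power2_eq_square less_1_mult)
  have ge: "x \<le> \<alpha> * x" if "x \<ge> 0" for x using assms(5) that mult_right_mono[of 1 \<alpha> x] by simp
  have "A \<ge> r" "B \<ge> \<sigma>" using ge[of r] ge[of \<sigma>] assms by auto
  then have AB: "A * B \<ge> r * \<sigma>" using assms by (intro mult_mono) auto
  have AB': "A - B = \<alpha> * q + \<epsilon>" unfolding q_def assms(2,3) by (simp add: algebra_simps)
  have "2 * A * B * (e - p) = q\<^sup>2 - (A - B)\<^sup>2 - 2 * ((A * B - r * \<sigma>) * (1 - e))"
    using law unfolding q_def by (simp add: power2_eq_square algebra_simps)
  also have "\<dots> \<le> q\<^sup>2 - (\<alpha> * q + \<epsilon>)\<^sup>2"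
    unfolding AB' using AB assms(4) by simp
  finally have "2 * A * B * (e - p) * (\<alpha>\<^sup>2 - 1) \<le> (q\<^sup>2 - (\<alpha> * q + \<epsilon>)\<^sup>2) * (\<alpha>\<^sup>2 - 1)"
    using k by (intro mult_right_mono) auto
  \<comment> \<open>Completing the square in \<open>q\<close> leaves a bound that no longer depends
    on \<open>q\<close>.\<close>
  also have "\<dots> = \<epsilon>\<^sup>2 - ((\<alpha>\<^sup>2 - 1) * q + \<alpha> * \<epsilon>)\<^sup>2"
    by (simp add: power2_eq_square algebra_simps)
  finally show ?thesis by (smt (verit) zero_le_power2)
qed

text \<open>Up to the factor \<alpha>, the left side is the time derivative of \<epsilon> along the
  motion. The bound must vanish with \<epsilon> for Gronwall's inequality to apply.\<close>

lemma dominance_excess_rate: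
  fixes xp xe y u :: "real^2"
  assumes "\<alpha> > 1" "l \<ge> 0" "norm (xp - xe) > l" "norm u = 1" and y: "y \<noteq> xe"
    and \<epsilon>: "\<epsilon> = norm (y - xp) - \<alpha> * norm (y - xe) - l" "\<epsilon> \<ge> 0"
  shows "(y - xe) \<bullet> u / norm (y - xe) -
      (y - xp) \<bullet> pursuit_direction \<alpha> l xp xe u / norm (y - xp)
    \<le> 2 * \<epsilon>\<^sup>2 / ((\<alpha>\<^sup>2 - 1) * (norm (xp - xe))\<^sup>2)"
proof -
  define z where "z = xe - xp"
  have z: "norm z > l" unfolding z_def using assms(3) by (simp add: norm_minus_commute)
  note H = assms(1,2) z assms(4)
  define \<sigma> where "\<sigma> = exit_dist \<alpha> l z u"
  define d where "d = norm (xp - xe)"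
  define A where "A = norm (y - xp)"
  define r where "r = norm (y - xe)"
  define B where "B = l + \<alpha> * \<sigma>"
  have d: "d > 0" "norm z = d" using z assms unfolding z_def d_def by (auto simp: norm_minus_commute)
  have k: "\<alpha>\<^sup>2 - 1 > 0" using assms by (simp add: power2_eq_square less_1_mult)
  have ge: "x \<le> \<alpha> * x" if "x \<ge> 0" for x using assms(1) that mult_right_mono[of 1 \<alpha> x] by simp
  have pos: "\<sigma> > 0" unfolding \<sigma>_def by (rule exit_dist_pos[OF H])
  have r: "r > 0" unfolding r_def using y by simp
  have A: "A = l + \<alpha> * r + \<epsilon>" unfolding A_def r_def \<epsilon> by simp
  have nB: "norm (z + \<sigma> *\<^sub>R u) = B" unfolding B_def \<sigma>_def by (rule norm_exit_dist[OF H])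
  \<comment> \<open>Since \<open>A \<ge> r\<close> and \<open>B \<ge> \<sigma>\<close>, the triangle
    inequality makes both \<open>A\<close> and \<open>B\<close> at least \<open>d / 2\<close>; this
    replaces \<open>A * B\<close> by \<open>d\<^sup>2 / 4\<close> in the final bound.\<close>
  have "d \<le> A + r" unfolding d_def A_def r_def
    using norm_triangle_ineq4[of "y - xe" "y - xp"] by (simp add: norm_minus_commute)
  then have A2: "2 * A \<ge> d" using ge[of r] r A assms by linarith
  have "d \<le> B + \<sigma>" unfolding d(2)[symmetric] nB[symmetric]
    using norm_triangle_ineq4[of "z + \<sigma> *\<^sub>R u" "\<sigma> *\<^sub>R u"] pos assms(4) by simp
  then have B2: "2 * B \<ge> d" using ge[of \<sigma>] pos B_def assms by linarith
  have AB: "A > 0" "B > 0" using A2 B2 d by auto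
  have AB4: "4 * (A * B) \<ge> d\<^sup>2"
    using mult_mono[OF A2 B2] d AB by (simp add: power2_eq_square)
  define e where "e = (y - xe) \<bullet> u / r"
  define p where "p = (y - xp) \<bullet> (z + \<sigma> *\<^sub>R u) / (A * B)"
  have e1: "e \<le> 1"
    unfolding e_def using r norm_cauchy_schwarz[of "y - xe" u] assms(4) by (simp add: r_def)
  have n1: "(norm (y - xe - \<sigma> *\<^sub>R u))\<^sup>2 = r\<^sup>2 + \<sigma>\<^sup>2 - 2 * r * \<sigma> * e"
    using r norm_ray_squared[OF assms(4), of "y - xe" "- \<sigma>"] unfolding e_def r_def by simp
  have n2: "(norm (y - xp - (z + \<sigma> *\<^sub>R u)))\<^sup>2 = A\<^sup>2 + B\<^sup>2 - 2 * A * B * p"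
  proof -
    have "(norm (v - w))\<^sup>2 = (norm v)\<^sup>2 + (norm w)\<^sup>2 - 2 * (v \<bullet> w)" for v w :: "real^2"
      by (simp add: power2_norm_eq_inner inner_diff inner_commute)
    from this[of "y - xp" "z + \<sigma> *\<^sub>R u"] show ?thesis
      using AB unfolding nB A_def[symmetric] p_def by simp
  qed
  have "y - xp - (z + \<sigma> *\<^sub>R u) = y - xe - \<sigma> *\<^sub>R u" unfolding z_def by simp
  then have law: "A\<^sup>2 + B\<^sup>2 - 2 * A * B * p = r\<^sup>2 + \<sigma>\<^sup>2 - 2 * r * \<sigma> * e"
    unfolding n1[symmetric] n2[symmetric] by (rule arg_cong)
  have cc: "2 * A * B * (e - p) * (\<alpha>\<^sup>2 - 1) \<le> \<epsilon>\<^sup>2"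
    using cosine_comparison[OF law A B_def e1 assms(1,2)] r pos \<epsilon>(2) by simp
  have "e - p \<le> 2 * \<epsilon>\<^sup>2 / ((\<alpha>\<^sup>2 - 1) * d\<^sup>2)"
  \<comment> \<open>The lower bound on \<open>A * B\<close> helps only where it multiplies a
    positive quantity.\<close>
  proof (cases "e - p \<le> 0")
    case True
    moreover have "0 \<le> 2 * \<epsilon>\<^sup>2 / ((\<alpha>\<^sup>2 - 1) * d\<^sup>2)" using k by simp
    ultimately show ?thesis by linarith
  next
    case False
    have "d\<^sup>2 * ((e - p) * (\<alpha>\<^sup>2 - 1)) \<le> 4 * (A * B) * ((e - p) * (\<alpha>\<^sup>2 - 1))"
      using AB4 False k by (intro mult_right_mono) auto
    also have "\<dots> = 2 * (2 * A * B * (e - p) * (\<alpha>\<^sup>2 - 1))" by simp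
    finally have "d\<^sup>2 * ((e - p) * (\<alpha>\<^sup>2 - 1)) \<le> 2 * \<epsilon>\<^sup>2" using cc by linarith
    then show ?thesis using k d by (simp add: pos_le_divide_eq mult_ac)
  qed
  moreover have "(y - xp) \<bullet> pursuit_direction \<alpha> l xp xe u / norm (y - xp) = p"
    unfolding pursuit_direction_eq[OF assms(1-4)] p_def A_def B_def z_def \<sigma>_def by simp
  ultimately show ?thesis unfolding e_def r_def d_def by simp
qed

section \<open>Regularity of controls and trajectories\<close>

lemma controls_norm: "u \<in> controls t0 \<Longrightarrow> t \<ge> t0 \<Longrightarrow> norm (u t) = 1"
  by (simp add: controls_def)

lemma controls_continuous:
  assumes "u \<in> controls t0"
  obtains S where "finite S" "continuous_on ({t0..T} - S) u"
proof (cases "T > t0")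
  case True
  then show ?thesis
    using that assms unfolding controls_def piecewise_continuous_from_def by blast
next
  case False
  \<comment> \<open>The definition speaks only of \<open>T > t0\<close>; otherwise the interval has
    at most the point \<open>t0\<close>, which is put into \<open>S\<close>.\<close>
  then have "{t0..T} - {t0} = {}" by auto
  then show ?thesis using that[of "{t0}"] by (metis continuous_on_empty finite.emptyI finite_insert)
qed

text \<open>Off a finite set the control is continuous, hence measurable, and dominated by the
  constant 1.\<close>

lemma controls_integrable:
  assumes "u \<in> controls t0"
  shows "u integrable_on {t0..T}"
proof -
  obtain S where S: "finite S" "continuous_on ({t0..T} - S) u"
    using controls_continuous[OF assms] .
  have m: "{t0..T} - S \<in> lmeasurable"
    using S(1) by (intro fmeasurable_Diff negligible_imp_sets negligible_finite) auto
  have "u integrable_on {t0..T} - S"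
  proof (rule measurable_bounded_by_integrable_imp_integrable)
    show "u \<in> borel_measurable (lebesgue_on ({t0..T} - S))"
      using m by (intro continuous_imp_measurable_on_sets_lebesgue[OF S(2)]) auto
    show "(\<lambda>_. 1::real) integrable_on {t0..T} - S"
      using m by (rule integrable_on_const)
    show "norm (u x) \<le> 1" if "x \<in> {t0..T} - S" for x
      using that controls_norm[OF assms] by simp
  qed (use m in auto)
  then show ?thesis
    by (rule integrable_spike_set) (auto intro: negligible_subset[OF negligible_finite[OF S(1)]])
qed

lemma continuous_on_atLeast:
  fixes f :: "real \<Rightarrow> 'a::topological_space"
  assumes "\<And>T. continuous_on {a..T} f"
  shows "continuous_on {a..} f"
  unfolding continuous_on_eq_continuous_within
proof
  fix x assume x: "x \<in> {a..}"
  have "at x within {a..x + 1} = at x within {a..}"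
    by (rule at_within_nhd[of x "{..<x + 1}"]) auto
  moreover have "continuous (at x within {a..x + 1}) f"
    using assms x by (auto simp: continuous_on_eq_continuous_within)
  ultimately show "continuous (at x within {a..}) f"
    by (simp add: continuous_within)
qed

lemma continuous_on_trajectory:
  assumes "u \<in> controls t0"
  shows "continuous_on {t0..} (trajectory s t0 x0 u)"
  unfolding trajectory_def
  by (intro continuous_on_atLeast continuous_intros indefinite_integral_continuous_1
      controls_integrable assms)

section \<open>Derivatives and differential inequalities off a finite set\<close>

lemma integral_has_vector_derivative_interior:
  fixes f :: "real \<Rightarrow> 'a::banach"
  assumes "f integrable_on {a..b}" "x \<in> {a<..<b}" "isCont f x"
  shows "((\<lambda>t. integral {a..t} f) has_vector_derivative f x) (at x)"
  using integral_has_vector_derivative_continuous_at[of f a b x "{}"] assms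
  by (simp add: at_within_Icc_at continuous_at_imp_continuous_at_within)

text \<open>The derivative may fail to exist where a control jumps, so the mean value theorem is
  replaced by the fundamental theorem of calculus with finitely many exceptional points.\<close>

lemma increment_le_of_derivative_le:
  fixes h :: "real \<Rightarrow> real"
  assumes "finite S" "a \<le> b" "continuous_on {a..b} h"
    and "\<And>x. x \<in> {a<..<b} - S \<Longrightarrow> \<exists>D. (h has_real_derivative D) (at x) \<and> D \<le> C"
  shows "h b - h a \<le> C * (b - a)"
proof -
  obtain D where D: "\<And>x. x \<in> {a<..<b} - S \<Longrightarrow> (h has_real_derivative D x) (at x) \<and> D x \<le> C"
    using assms(4) by metis
  \<comment> \<open>The value \<open>C\<close> at exceptional points keeps the integrand bounded by
    \<open>C\<close> on the whole interval.\<close>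
  define g where "g x = (if x \<in> {a<..<b} - S then D x else C)" for x
  have "(g has_integral (h b - h a)) {a..b}"
    using assms(1-3) D
    by (intro fundamental_theorem_of_calculus_interior_strong)
      (auto simp: g_def has_real_derivative_iff_has_vector_derivative)
  moreover have "((\<lambda>_. C) has_integral C * (b - a)) {a..b}"
    using has_integral_const_real[of C a b] assms(2) by (simp add: mult.commute)
  ultimately show ?thesis
    by (rule has_integral_le) (use D in \<open>auto simp: g_def\<close>)
qed

text \<open>With the integrating factor \<open>exp (- K * x)\<close> the function becomes
  nonincreasing.\<close>

lemma gronwall_nonpos:
  fixes h :: "real \<Rightarrow> real"
  assumes "finite S" "a \<le> b" "continuous_on {a..b} h" "h a \<le> 0"
    and "\<And>x. x \<in> {a<..<b} - S \<Longrightarrow> \<exists>D. (h has_real_derivative D) (at x) \<and> D \<le> K * h x"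
  shows "h b \<le> 0"
proof -
  define g where "g x = h x * exp (- K * x)" for x
  have "g b - g a \<le> 0 * (b - a)"
  proof (rule increment_le_of_derivative_le[OF assms(1,2)])
    show "continuous_on {a..b} g" unfolding g_def by (intro continuous_intros assms)
    fix x assume "x \<in> {a<..<b} - S"
    then obtain D where D: "(h has_real_derivative D) (at x)" "D \<le> K * h x" using assms(5) by blast
    have "(g has_real_derivative (D - K * h x) * exp (- K * x)) (at x)"
      unfolding g_def by (rule derivative_eq_intros D refl | simp add: algebra_simps)+
    moreover have "(D - K * h x) * exp (- K * x) \<le> 0"
      using D(2) by (simp add: mult_nonpos_nonneg)
    ultimately show "\<exists>D. (g has_real_derivative D) (at x) \<and> D \<le> 0" by blast
  qed
  then have "g b \<le> 0" using assms(4) unfolding g_def by (smt (verit) exp_gt_zero mult_nonpos_nonneg)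
  then show ?thesis unfolding g_def by (simp add: mult_le_0_iff)
qed

lemma norm_has_real_derivative:
  fixes f :: "real \<Rightarrow> 'a::real_inner"
  assumes "(f has_vector_derivative f') (at x)" "f x \<noteq> 0"
  shows "((\<lambda>t. norm (f t)) has_real_derivative f x \<bullet> f' / norm (f x)) (at x)"
proof -
  have "(f has_derivative (\<lambda>t. t *\<^sub>R f')) (at x)"
    using assms(1) by (simp add: has_vector_derivative_def)
  from has_derivative_compose[OF this has_derivative_norm[OF assms(2)]]
  show ?thesis
    unfolding has_field_derivative_def
    by (rule has_derivative_eq_rhs) (auto simp: sgn_div_norm inner_commute divide_inverse)
qed

section \<open>The capture time as an infimum\<close>

lemma capture_time_ge: "ereal t0 \<le> capture_time l t0 xp xe"
  unfolding capture_time_def by (rule Inf_greatest) auto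

lemma before_capture:
  assumes "ereal t < capture_time l t0 xp xe" "t0 \<le> t"
  shows "norm (xp t - xe t) > l"
proof (rule ccontr)
  assume "\<not> ?thesis"
  then have "capture_time l t0 xp xe \<le> ereal t"
    unfolding capture_time_def using assms(2) by (intro Inf_lower) auto
  then show False using assms(1) by simp
qed

lemma capture_time_le: "t0 \<le> t \<Longrightarrow> norm (xp t - xe t) \<le> l \<Longrightarrow> capture_time l t0 xp xe \<le> ereal t"
  unfolding capture_time_def by (intro Inf_lower) auto

text \<open>Continuity makes the set of capture instants closed, so a finite infimum belongs to
  it.\<close>

lemma capture_time_attained:
  assumes "continuous_on {t0..} xp" "continuous_on {t0..} xe"
    and "capture_time l t0 xp xe < \<infinity>"
  obtains t where "t0 \<le> t" "norm (xp t - xe t) \<le> l" "capture_time l t0 xp xe = ereal t"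
proof -
  define C where "C = {t. t0 \<le> t \<and> norm (xp t - xe t) \<le> l}"
  have ne: "C \<noteq> {}"
    using assms(3) unfolding capture_time_def C_def[symmetric] by (auto simp: top_ereal_def)
  have bdd: "bdd_below C" unfolding C_def by (auto intro: bdd_belowI[of _ t0])
  have "continuous_on {t0..} (\<lambda>t. norm (xp t - xe t))" by (intro continuous_intros assms)
  then have "closed ({t0..} \<inter> (\<lambda>t. norm (xp t - xe t)) -` {..l})"
    by (rule continuous_closed_preimage) auto
  moreover have "{t0..} \<inter> (\<lambda>t. norm (xp t - xe t)) -` {..l} = C" unfolding C_def by auto
  ultimately have mem: "Inf C \<in> C" using closed_contains_Inf[OF ne bdd] by simp
  have "ereal (Inf C) \<le> capture_time l t0 xp xe"
    unfolding capture_time_def C_def[symmetric]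
    by (rule Inf_greatest) (auto intro: cInf_lower[OF _ bdd])
  moreover have "capture_time l t0 xp xe \<le> ereal (Inf C)"
    using mem unfolding C_def by (intro capture_time_le) auto
  ultimately have "capture_time l t0 xp xe = ereal (Inf C)" by simp
  with mem that show ?thesis unfolding C_def by blast
qed

section \<open>Motion along a feedback solution for one evader control\<close>

locale pursuit =
  fixes \<alpha> l t0 :: real and xp0 xe0 :: "real^2" and ue xp xe :: "real \<Rightarrow> real^2"
  assumes alpha: "\<alpha> > 1" and l: "l \<ge> 0"
    and ue: "ue \<in> controls t0"
    and sol: "feedback_solution \<alpha> l t0 xp0 xe ue xp"
    and xe: "xe = trajectory 1 t0 xe0 ue"
begin

text \<open>This is the capture time along the feedback solution \<open>xp\<close>; its relation to
  the trajectory generated by the strategy's control is established in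
  \<open>terminal_time_le\<close>.\<close>

abbreviation T :: ereal where "T \<equiv> capture_time l t0 xp xe"

abbreviation \<gamma> :: "real \<Rightarrow> real^2" where "\<gamma> t \<equiv> pursuit_direction \<alpha> l (xp t) (xe t) (ue t)"

lemma cont_xe: "continuous_on {t0..} xe"
  unfolding xe by (rule continuous_on_trajectory[OF ue])

lemma cont_xp: "continuous_on {t0..} xp"
  using sol by (simp add: feedback_solution_def)

lemma xp_integral:
  "t0 \<le> t \<Longrightarrow> ereal t \<le> T \<Longrightarrow> ((\<lambda>s. \<alpha> *\<^sub>R \<gamma> s) has_integral (xp t - xp0)) {t0..t}"
  using sol by (simp add: feedback_solution_def)

lemma xp_init: "xp t0 = xp0"
  using xp_integral[of t0] capture_time_ge[of t0 l xp xe]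
  by (auto dest: has_integral_unique[OF has_integral_refl(2)])

lemma xe_init: "xe t0 = xe0"
  unfolding xe trajectory_def by simp

text \<open>All of \<open>{t0<..<b}\<close> precedes capture, so near \<open>s\<close> the direction
  agrees with the explicit formula \<open>F\<close>, whose denominators do not vanish.\<close>

lemma isCont_direction:
  assumes b: "ereal b < T" and s: "s \<in> {t0<..<b}" and u: "isCont ue s"
  shows "isCont \<gamma> s"
proof -
  have far: "norm (xp t - xe t) > l" if "t \<in> {t0<..<b}" for t
    using that less_trans[OF _ b, of "ereal t"] by (intro before_capture[of _ _ t0]) auto
  have int: "s \<in> interior {t0..}" using s by simp
  have c: "isCont xp s" "isCont xe s"
    using continuous_on_interior[OF cont_xp int] continuous_on_interior[OF cont_xe int] by auto
  define F where "F t = (1 / (l + \<alpha> * exit_dist \<alpha> l (xe t - xp t) (ue t))) *\<^sub>R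
    (xe t - xp t + exit_dist \<alpha> l (xe t - xp t) (ue t) *\<^sub>R ue t)" for t
  have k: "\<alpha>\<^sup>2 - 1 \<noteq> 0" using alpha by (simp add: power2_eq_1_iff)
  have z: "norm (xe s - xp s) > l" using far[OF s] by (simp add: norm_minus_commute)
  have "exit_dist \<alpha> l (xe s - xp s) (ue s) > 0"
    using exit_dist_pos[OF alpha l z] controls_norm[OF ue] s by simp
  then have n: "l + \<alpha> * exit_dist \<alpha> l (xe s - xp s) (ue s) \<noteq> 0"
    using alpha l by (smt (verit) mult_pos_pos)
  have e: "isCont (\<lambda>t. exit_dist \<alpha> l (xe t - xp t) (ue t)) s"
    unfolding exit_dist_def using k by (intro continuous_intros c u) auto
  have F: "isCont F s" unfolding F_def using n by (intro continuous_intros e c u) auto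
  have "eventually (\<lambda>t. F t = \<gamma> t) (nhds s)"
    using eventually_nhds_in_open[of "{t0<..<b}" s] s
    by (auto elim!: eventually_mono simp: F_def pursuit_direction_eq[OF alpha l far controls_norm[OF ue]])
  from isCont_cong[OF this] F show ?thesis by simp
qed

lemma derivatives:
  assumes b: "ereal b < T"
  shows "\<exists>S. finite S \<and> (\<forall>s\<in>{t0<..<b} - S.
    (xp has_vector_derivative \<alpha> *\<^sub>R \<gamma> s) (at s) \<and> (xe has_vector_derivative ue s) (at s))"
proof -
  obtain S where S: "finite S" "continuous_on ({t0..b} - S) ue"
    using controls_continuous[OF ue] .
  have c: "isCont ue s" if "s \<in> {t0<..<b} - S" for s
  proof -
    \<comment> \<open>Removing finitely many points leaves an open set, on which continuity of the
      restriction is continuity at each point.\<close>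
    have "open ({t0<..<b} - S)" using S(1) by (simp add: finite_imp_closed open_Diff)
    moreover have "continuous_on ({t0<..<b} - S) ue" by (rule continuous_on_subset[OF S(2)]) auto
    ultimately show ?thesis using that continuous_on_eq_continuous_at by blast
  qed
  have "(xp has_vector_derivative \<alpha> *\<^sub>R \<gamma> s) (at s)" if s: "s \<in> {t0<..<b} - S" for s
  proof -
    have "(\<lambda>s. \<alpha> *\<^sub>R \<gamma> s) integrable_on {t0..b}"
      using xp_integral[of b] s less_imp_le[OF b] by (auto intro: has_integral_integrable)
    then have "((\<lambda>t. integral {t0..t} (\<lambda>s. \<alpha> *\<^sub>R \<gamma> s)) has_vector_derivative \<alpha> *\<^sub>R \<gamma> s) (at s)"
      using s isCont_direction[OF b _ c[OF s]]
      by (intro integral_has_vector_derivative_interior continuous_intros) auto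
    then have "((\<lambda>t. xp0 + integral {t0..t} (\<lambda>s. \<alpha> *\<^sub>R \<gamma> s)) has_vector_derivative \<alpha> *\<^sub>R \<gamma> s) (at s)"
      using has_vector_derivative_add[OF has_vector_derivative_const, of _ _ "at s" xp0] by fastforce
    then show ?thesis
    proof (rule has_vector_derivative_transform_within_open[of _ _ _ "{t0<..<b}"])
      fix t assume t: "t \<in> {t0<..<b}"
      then have "ereal t \<le> T" using less_trans[OF _ b, of "ereal t"] by simp
      then show "xp0 + integral {t0..t} (\<lambda>s. \<alpha> *\<^sub>R \<gamma> s) = xp t"
        using integral_unique[OF xp_integral[of t]] t by auto
    qed (use s in auto)
  qed
  moreover have "(xe has_vector_derivative ue s) (at s)" if s: "s \<in> {t0<..<b} - S" for s
  proof -
    have "((\<lambda>t. integral {t0..t} ue) has_vector_derivative ue s) (at s)"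
      using s by (intro integral_has_vector_derivative_interior[of _ _ b] controls_integrable ue c) auto
    then show ?thesis unfolding xe trajectory_def by (auto intro!: derivative_eq_intros)
  qed
  ultimately show ?thesis using S(1) by blast
qed

lemma capture_time_bound: "T \<le> ereal (t0 + norm (xe0 - xp0) * \<alpha> / (\<alpha> - 1)\<^sup>2)"
proof (rule ccontr)
  \<comment> \<open>At this time a distance shrinking at rate \<kappa> from its initial value would
    reach zero.\<close>
  define b where "b = t0 + norm (xe0 - xp0) * \<alpha> / (\<alpha> - 1)\<^sup>2"
  define \<kappa> where "\<kappa> = (\<alpha> - 1)\<^sup>2 / \<alpha>"
  assume "\<not> ?thesis"
  then have b: "ereal b < T" unfolding b_def by simp
  have t0b: "t0 \<le> b" unfolding b_def using alpha by simp
  obtain S where S: "finite S"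
    "\<And>s. s \<in> {t0<..<b} - S \<Longrightarrow> (xp has_vector_derivative \<alpha> *\<^sub>R \<gamma> s) (at s)"
    "\<And>s. s \<in> {t0<..<b} - S \<Longrightarrow> (xe has_vector_derivative ue s) (at s)"
    using derivatives[OF b] by blast
  have far: "norm (xp t - xe t) > l" if "t \<in> {t0..b}" for t
    using that le_less_trans[OF _ b, of "ereal t"] by (intro before_capture[of _ _ t0]) auto
  have "norm (xe b - xp b) - norm (xe t0 - xp t0) \<le> - \<kappa> * (b - t0)"
  proof (rule increment_le_of_derivative_le[OF S(1) t0b])
    show "continuous_on {t0..b} (\<lambda>t. norm (xe t - xp t))"
      by (intro continuous_intros continuous_on_subset[OF cont_xe] continuous_on_subset[OF cont_xp]) auto
    fix s assume s: "s \<in> {t0<..<b} - S"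
    then have d: "norm (xp s - xe s) > l" using far by simp
    then have pos: "norm (xe s - xp s) > 0" "xe s - xp s \<noteq> 0" using l by (auto simp: norm_minus_commute)
    have "((\<lambda>t. norm (xe t - xp t)) has_real_derivative
        (xe s - xp s) \<bullet> (ue s - \<alpha> *\<^sub>R \<gamma> s) / norm (xe s - xp s)) (at s)"
      using S(2,3)[OF s] pos(2)
      by (intro norm_has_real_derivative has_vector_derivative_diff) auto
    moreover have "(xe s - xp s) \<bullet> (ue s - \<alpha> *\<^sub>R \<gamma> s) / norm (xe s - xp s) \<le> - \<kappa>"
      using closing_speed[OF alpha l d controls_norm[OF ue]] s pos(1)
      by (simp add: pos_divide_le_eq \<kappa>_def)
    ultimately show "\<exists>D. ((\<lambda>t. norm (xe t - xp t)) has_real_derivative D) (at s) \<and> D \<le> - \<kappa>"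
      by blast
  qed
  moreover have "\<kappa> * (b - t0) = norm (xe0 - xp0)"
    unfolding \<kappa>_def b_def using alpha by simp
  ultimately have "norm (xe b - xp b) \<le> 0" by (simp add: xp_init xe_init)
  then show False using far[of b] t0b l by simp
qed

text \<open>Were the claim false, \<open>E\<close> for the fixed target \<open>y = xe t\<close>
  would start nonpositive and be positive at the first visit \<open>t2\<close> to \<open>y\<close>.
  Gronwall's inequality on the last stretch where \<open>E\<close> is positive excludes
  this.\<close>

lemma evader_stays:
  assumes t: "t0 \<le> t" "ereal t < T"
  shows "xe t \<in> dominance_region \<alpha> l xp0 xe0"
proof (rule ccontr)
  define y where "y = xe t"
  define E where "E s = norm (y - xp s) - \<alpha> * norm (y - xe s) - l" for s
  assume "xe t \<notin> dominance_region \<alpha> l xp0 xe0"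
  then have E0: "E t0 \<le> 0"
    unfolding E_def dominance_region_def xp_init xe_init y_def by simp
  have sub: "continuous_on {a..b} xp" "continuous_on {a..b} xe" if "t0 \<le> a" for a b
    using that by (auto intro: continuous_on_subset[OF cont_xp] continuous_on_subset[OF cont_xe])
  have contE: "continuous_on {a..b} E" if "t0 \<le> a" for a b
    unfolding E_def by (intro continuous_intros sub that)
  have far: "norm (xp s - xe s) > l" if "s \<in> {t0..t}" for s
    using that le_less_trans[OF _ t(2), of "ereal s"] by (intro before_capture[of _ _ t0]) auto
  \<comment> \<open>Up to the first visit to \<open>y\<close> the distance from the evader to \<open>y\<close> is positive, hence differentiable.\<close>
  define H where "H = {t0..t} \<inter> xe -` {y}"
  have "closed H"
    unfolding H_def by (intro continuous_closed_preimage sub) auto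
  moreover have bddH: "bdd_below H" unfolding H_def by (auto intro: bdd_belowI[of _ t0])
  moreover have "t \<in> H" unfolding H_def y_def using t by simp
  ultimately have infH: "Inf H \<in> H" using closed_contains_Inf[of H] by blast
  define t2 where "t2 = Inf H"
  have t2: "t0 \<le> t2" "t2 \<le> t" "xe t2 = y" using infH unfolding H_def t2_def by auto
  \<comment> \<open>At \<open>t2\<close> the evader is at \<open>y\<close>, so \<open>E t2\<close>
    is the distance between the players minus \<open>l\<close>.\<close>
  have E2: "E t2 > 0"
    using far[of t2] t2 unfolding E_def by (simp add: norm_minus_commute)
  have ne: "xe s \<noteq> y" if "t0 \<le> s" "s < t2" for s
  proof
    assume "xe s = y"
    then have "s \<in> H" using that t2 unfolding H_def by auto
    then have "t2 \<le> s" unfolding t2_def by (rule cInf_lower[OF _ bddH])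
    then show False using that by simp
  qed
  \<comment> \<open>The supremum \<open>t1\<close> of \<open>G\<close> is the last time up to
    \<open>t2\<close> with \<open>E\<close> nonpositive; after it \<open>E\<close> has the sign that
    the rate estimate requires.\<close>
  define G where "G = {t0..t2} \<inter> E -` {..0}"
  have "closed G"
    unfolding G_def by (intro continuous_closed_preimage contE) auto
  moreover have bddG: "bdd_above G" unfolding G_def by (auto intro: bdd_aboveI[of _ t2])
  moreover have "t0 \<in> G" unfolding G_def using t2 E0 by simp
  ultimately have supG: "Sup G \<in> G" using closed_contains_Sup[of G] by blast
  define t1 where "t1 = Sup G"
  have t1: "t0 \<le> t1" "t1 \<le> t2" "E t1 \<le> 0" using supG unfolding G_def t1_def by auto
  have pos: "E s > 0" if "t1 < s" "s \<le> t2" for s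
  proof (rule ccontr)
    assume "\<not> ?thesis"
    then have "s \<in> G" using that t1 unfolding G_def by auto
    then have "s \<le> t1" unfolding t1_def by (rule cSup_upper[OF _ bddG])
    then show False using that by simp
  qed
  obtain S where S: "finite S"
    "\<And>s. s \<in> {t0<..<t} - S \<Longrightarrow> (xp has_vector_derivative \<alpha> *\<^sub>R \<gamma> s) (at s)"
    "\<And>s. s \<in> {t0<..<t} - S \<Longrightarrow> (xe has_vector_derivative ue s) (at s)"
    using derivatives[OF t(2)] by blast
  \<comment> \<open>One factor \<open>E s\<close> is split off the quadratic bound. The remaining
    coefficient is continuous because the players stay apart, and compactness bounds it by a
    constant \<open>K\<close>.\<close>
  define \<phi> where "\<phi> s = 2 * \<alpha> * E s / ((\<alpha>\<^sup>2 - 1) * (norm (xp s - xe s))\<^sup>2)" for s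
  have k: "\<alpha>\<^sup>2 - 1 \<noteq> 0" using alpha by (simp add: power2_eq_1_iff)
  have nz: "xp s \<noteq> xe s" if "s \<in> {t1..t2}" for s
    using far[of s] l that t1 t2 by auto
  have "continuous_on {t1..t2} \<phi>"
    unfolding \<phi>_def using k nz by (intro continuous_intros contE sub t1) auto
  then have "\<exists>x\<in>{t1..t2}. \<forall>s\<in>{t1..t2}. \<phi> s \<le> \<phi> x"
    using t1(2) by (intro continuous_attains_sup) auto
  then obtain K where K: "\<And>s. s \<in> {t1..t2} \<Longrightarrow> \<phi> s \<le> K" by blast
  have "E t2 \<le> 0"
  proof (rule gronwall_nonpos[OF S(1) t1(2) contE[OF t1(1)] t1(3)])
    fix s assume "s \<in> {t1<..<t2} - S"
    then have s: "t1 < s" "s < t2" "s \<in> {t0<..<t} - S" using t1 t2 by auto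
    have Es: "E s > 0" using pos s by simp
    have r: "y - xe s \<noteq> 0" using ne[of s] s by auto
    have A: "y - xp s \<noteq> 0"
    proof
      assume "y - xp s = 0"
      moreover have "0 \<le> \<alpha> * norm (y - xe s)" using alpha by simp
      ultimately have "E s \<le> 0" using l unfolding E_def by simp
      then show False using Es by simp
    qed
    define R where "R = (y - xe s) \<bullet> ue s / norm (y - xe s) - (y - xp s) \<bullet> \<gamma> s / norm (y - xp s)"
    have "((\<lambda>s. norm (y - xp s)) has_real_derivative
        (y - xp s) \<bullet> (0 - \<alpha> *\<^sub>R \<gamma> s) / norm (y - xp s)) (at s)"
      using A S(2)[OF s(3)]
      by (intro norm_has_real_derivative has_vector_derivative_diff has_vector_derivative_const)
    moreover have "((\<lambda>s. norm (y - xe s)) has_real_derivative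
        (y - xe s) \<bullet> (0 - ue s) / norm (y - xe s)) (at s)"
      using r S(3)[OF s(3)]
      by (intro norm_has_real_derivative has_vector_derivative_diff has_vector_derivative_const)
    ultimately have "(E has_real_derivative \<alpha> * R) (at s)"
      unfolding E_def R_def by (auto intro!: derivative_eq_intros simp: right_diff_distrib)
    moreover have "\<alpha> * R \<le> K * E s"
    proof -
      have "R \<le> 2 * (E s)\<^sup>2 / ((\<alpha>\<^sup>2 - 1) * (norm (xp s - xe s))\<^sup>2)"
        unfolding R_def using far[of s] s Es r controls_norm[OF ue, of s]
        by (intro dominance_excess_rate alpha l) (auto simp: E_def)
      then have "\<alpha> * R \<le> \<alpha> * (2 * (E s)\<^sup>2 / ((\<alpha>\<^sup>2 - 1) * (norm (xp s - xe s))\<^sup>2))"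
        using alpha by (intro mult_left_mono) auto
      also have "\<dots> = \<phi> s * E s" unfolding \<phi>_def by (simp add: power2_eq_square)
      also have "\<dots> \<le> K * E s" using K[of s] s Es by (intro mult_right_mono) auto
      finally show ?thesis .
    qed
    ultimately show "\<exists>D. (E has_real_derivative D) (at s) \<and> D \<le> K * E s" by blast
  qed
  then show False using E2 by simp
qed

text \<open>The trajectory of \<open>up\<close> meets \<open>xp\<close> at the capture instant, so
  it has captured by then. This inequality serves both claims: it transfers the time bound, and it
  places every time before the terminal time before \<open>T\<close>.\<close>

lemma terminal_time_le:
  assumes eq: "\<And>t. t0 \<le> t \<Longrightarrow> ereal t < T \<Longrightarrow> up t = \<gamma> t"
  shows "terminal_time \<alpha> l t0 xp0 xe0 up ue \<le> T"
proof -
  have "T < \<infinity>" using capture_time_bound by (rule le_less_trans) simp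
  then obtain t where t: "t0 \<le> t" "norm (xp t - xe t) \<le> l" "T = ereal t"
    using capture_time_attained[OF cont_xp cont_xe] by blast
  have "((\<lambda>s. \<alpha> *\<^sub>R \<gamma> s) has_integral (xp t - xp0)) {t0..t}"
    using t by (intro xp_integral) auto
  then have "((\<lambda>s. \<alpha> *\<^sub>R up s) has_integral (xp t - xp0)) {t0..t}"
  \<comment> \<open>The hypothesis prescribes \<open>up\<close> strictly before \<open>T\<close>
    only; the endpoint is a single point and does not affect the integral.\<close>
  proof (rule has_integral_spike_finite[of "{t}", rotated 2])
    fix s assume "s \<in> {t0..t} - {t}"
    then show "\<alpha> *\<^sub>R up s = \<alpha> *\<^sub>R \<gamma> s" using eq[of s] t(3) by auto
  qed simp
  then have "\<alpha> *\<^sub>R integral {t0..t} up = xp t - xp0"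
    by (simp add: integral_unique flip: integral_cmul)
  then have "trajectory \<alpha> t0 xp0 up t = xp t" unfolding trajectory_def by simp
  then show ?thesis
    unfolding terminal_time_def t(3) using t xe by (intro capture_time_le) auto
qed

end

theorem theorem7:
  fixes \<alpha> l t0 :: real and xp0 xe0 :: "real^2"
    and \<delta> :: "(real \<Rightarrow> real^2) \<Rightarrow> (real \<Rightarrow> real^2)"
  assumes "\<alpha> > 1" and "l \<ge> 0"
    and "norm (xp0 - xe0) > l"
    and "is_delta_star \<alpha> l t0 xp0 xe0 \<delta>"
  shows "(\<exists>c>0. \<forall>ue\<in>controls t0. terminal_time \<alpha> l t0 xp0 xe0 (\<delta> ue) ue < ereal c) \<and>
    (\<forall>ue\<in>controls t0. \<forall>t\<ge>t0. ereal t < terminal_time \<alpha> l t0 xp0 xe0 (\<delta> ue) ue \<longrightarrow>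
       trajectory 1 t0 xe0 ue t \<in> dominance_region \<alpha> l xp0 xe0)"
proof -
  \<comment> \<open>This bound depends on the initial data but not on \<open>ue\<close>, so it is
    uniform over all evader controls.\<close>
  define b where "b = t0 + norm (xe0 - xp0) * \<alpha> / (\<alpha> - 1)\<^sup>2"
  have *: "terminal_time \<alpha> l t0 xp0 xe0 (\<delta> ue) ue \<le> ereal b \<and>
      (\<forall>t\<ge>t0. ereal t < terminal_time \<alpha> l t0 xp0 xe0 (\<delta> ue) ue \<longrightarrow>
        trajectory 1 t0 xe0 ue t \<in> dominance_region \<alpha> l xp0 xe0)" if ue: "ue \<in> controls t0" for ue
  proof -
    obtain xp where sol: "feedback_solution \<alpha> l t0 xp0 (trajectory 1 t0 xe0 ue) ue xp"
      and eq: "\<And>t. t0 \<le> t \<Longrightarrow> ereal t < capture_time l t0 xp (trajectory 1 t0 xe0 ue) \<Longrightarrow>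
        \<delta> ue t = pursuit_direction \<alpha> l (xp t) (trajectory 1 t0 xe0 ue t) (ue t)"
      using assms(4) ue unfolding is_delta_star_def by blast
    interpret pursuit \<alpha> l t0 xp0 xe0 ue xp "trajectory 1 t0 xe0 ue"
      using assms(1,2) ue sol by unfold_locales auto
    have le: "terminal_time \<alpha> l t0 xp0 xe0 (\<delta> ue) ue \<le> T"
      using terminal_time_le[OF eq] .
    show ?thesis
      using le capture_time_bound evader_stays unfolding b_def
      by (meson less_le_trans order_trans)
  qed
  \<comment> \<open>Adding 1 makes the inequality strict; the maximum ensures positivity, since
    \<open>t0\<close> and hence \<open>b\<close> may be negative.\<close>
  have "terminal_time \<alpha> l t0 xp0 xe0 (\<delta> ue) ue < ereal (max 1 (b + 1))" if "ue \<in> controls t0" for ue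
  proof -
    have "ereal b < ereal (max 1 (b + 1))" by (simp only: ereal_less_eq less_ereal.simps)
    with *[OF that] show ?thesis by (blast intro: le_less_trans)
  qed
  moreover have "max 1 (b + 1) > 0" by simp
  ultimately show ?thesis using * by blast
qed

end
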